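(* Let $G$ be a directed acyclic graph with a single sink. Let $\pi$ be a Monomial Calculus refutation of (the polynomial encoding of) $\mathrm{Peb}(G)$ with degree $s$ and size $t$. Then there is a black pebbling strategy for $G$ with $s$ pebbles and time $t+s$.
   Context: Black pebbling: for a DAG $G=(V,E)$ with unique sink $z$, a black pebbling is a sequence of sets $B_0,\dots,B_T\subseteq V$ with $B_0=B_T=\emptyset$, $z\in B_i$ for some $i$, and each $B_j$ obtained from $B_{j-1}$ either by placing a pebble on a vertex $v\notin B_{j-1}$ with all direct predecessors of $v$ in $B_{j-1}$, or by removing any pebble. Time is $T$; space (number of pebbles) is $\max_j|B_j|$. Pebbling formula $\mathrm{Peb}(G)$: variables $x_v$, clauses $\bigvee_{u\in\mathrm{pred}(v)}\bar x_u\vee x_v$ for each $v\in V$ and $\bar x_z$. Polynomial encoding over a field $\mathbb F$: $A_v=\big(\prod_{u\in\mathrm{pred}(v)}x_u\big)(1-x_v)$ for each $v$, and $x_z$; Boolean axioms $x_v^2-x_v$ available. Monomial Calculus: a refutation of a set of polynomials $\mathcal P$ is a sequence of polynomials ending in $1$, each in $\mathcal P$, a Boolean axiom, or obtained from earlier ones by linear combination ($\alpha p+\beta q$, $\alpha,\beta\in\mathbb F$) or by multiplication $p\mapsto x_ip$ where $p$ is a monomial or the product of a monomial and an axiom. Degree: maximum degree of its polynomials. Size: total number of monomials over all polynomials, fully expanded, counted with repetitions. *)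

theory Defs
  imports "Graph_Theory.Pair_Digraph" "HOL-Library.Poly_Mapping"
begin

subsection \<open>Graphs and black pebblings\<close>

definition preds :: "'a pair_pre_digraph \<Rightarrow> 'a \<Rightarrow> 'a set" where
  "preds G v = {u. (u, v) \<in> parcs G}"

definition sinks :: "'a pair_pre_digraph \<Rightarrow> 'a set" where
  "sinks G = {v \<in> pverts G. \<forall>w. (v, w) \<notin> parcs G}"

definition single_sink_dag :: "'a pair_pre_digraph \<Rightarrow> 'a \<Rightarrow> bool" where
  "single_sink_dag G z \<longleftrightarrow> pair_fin_digraph G \<and> acyclic (parcs G) \<and> sinks G = {z}"

definition pebbling_move :: "'a pair_pre_digraph \<Rightarrow> 'a set \<Rightarrow> 'a set \<Rightarrow> bool" where
  "pebbling_move G B B' \<longleftrightarrow>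
     (\<exists>v \<in> pverts G. v \<notin> B \<and> preds G v \<subseteq> B \<and> B' = insert v B) \<or>
     (\<exists>v \<in> B. B' = B - {v})"

text \<open>The list \<open>Bs\<close> is the sequence \<open>B\<^sub>0, \<dots>, B\<^sub>T\<close>, so it has length \<open>T + 1\<close>.\<close>
definition black_pebbling :: "'a pair_pre_digraph \<Rightarrow> 'a \<Rightarrow> 'a set list \<Rightarrow> bool" where
  "black_pebbling G z Bs \<longleftrightarrow>
     Bs \<noteq> [] \<and> (\<forall>B \<in> set Bs. B \<subseteq> pverts G) \<and>
     hd Bs = {} \<and> last Bs = {} \<and> (\<exists>B \<in> set Bs. z \<in> B) \<and>
     (\<forall>j. 0 < j \<and> j < length Bs \<longrightarrow> pebbling_move G (Bs ! (j - 1)) (Bs ! j))"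

definition pebbling_time :: "'a set list \<Rightarrow> nat" where
  "pebbling_time Bs = length Bs - 1"

definition pebbling_space :: "'a set list \<Rightarrow> nat" where
  "pebbling_space Bs = Max (card ` set Bs)"

subsection \<open>Polynomials\<close>

text \<open>An exponent vector is a finitely supported function from variables to \<open>nat\<close>, and a
  polynomial is a finitely supported function from exponent vectors to coefficients; the ring
  operations are those of \<open>poly_mapping\<close>. Exponents are not reduced modulo the Boolean axioms.\<close>
type_synonym ('v, 'k) mpoly = "('v \<Rightarrow>\<^sub>0 nat) \<Rightarrow>\<^sub>0 'k"

definition mvar :: "'v \<Rightarrow> ('v, 'k::field) mpoly" where
  "mvar v = Poly_Mapping.single (Poly_Mapping.single v 1) 1"

definition mconst :: "'k \<Rightarrow> ('v, 'k::field) mpoly" where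
  "mconst c = Poly_Mapping.single 0 c"

text \<open>A monomial may carry a nonzero coefficient. This only makes the multiplication rule below
  more permissive; monomials with coefficient 1 are the case \<open>c = 1\<close>.\<close>
definition is_monomial :: "('v, 'k::field) mpoly \<Rightarrow> bool" where
  "is_monomial p \<longleftrightarrow> (\<exists>m c. c \<noteq> 0 \<and> p = Poly_Mapping.single m c)"

definition num_monomials :: "('v, 'k::field) mpoly \<Rightarrow> nat" where
  "num_monomials p = card (Poly_Mapping.keys p)"

definition monom_degree :: "('v \<Rightarrow>\<^sub>0 nat) \<Rightarrow> nat" where
  "monom_degree m = (\<Sum>v \<in> Poly_Mapping.keys m. Poly_Mapping.lookup m v)"

text \<open>Total degree; the zero polynomial, which may occur as a line, has degree 0.\<close>
definition total_degree :: "('v, 'k::field) mpoly \<Rightarrow> nat" where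
  "total_degree p = Max (insert 0 (monom_degree ` Poly_Mapping.keys p))"

subsection \<open>Monomial Calculus\<close>

definition boolean_axioms :: "'v set \<Rightarrow> ('v, 'k::field) mpoly set" where
  "boolean_axioms V = {mvar v ^ 2 - mvar v |v. v \<in> V}"

text \<open>\<open>mc_step V P ps q\<close>: over the variables \<open>V\<close> and from the polynomials \<open>P\<close>, the line \<open>q\<close> may
  follow the lines in \<open>ps\<close>.\<close>
definition mc_step ::
  "'v set \<Rightarrow> ('v, 'k::field) mpoly set \<Rightarrow> ('v, 'k) mpoly set \<Rightarrow> ('v, 'k) mpoly \<Rightarrow> bool" where
  "mc_step V P ps q \<longleftrightarrow>
     q \<in> P \<union> boolean_axioms V \<or>
     (\<exists>a b. \<exists>p \<in> ps. \<exists>p' \<in> ps. q = mconst a * p + mconst b * p') \<or>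
     (\<exists>v \<in> V. \<exists>p \<in> ps. q = mvar v * p \<and>
        (is_monomial p \<or>
         (\<exists>m. \<exists>A \<in> P \<union> boolean_axioms V. is_monomial m \<and> p = m * A)))"

definition mc_refutation ::
  "'v set \<Rightarrow> ('v, 'k::field) mpoly set \<Rightarrow> ('v, 'k) mpoly list \<Rightarrow> bool" where
  "mc_refutation V P \<pi> \<longleftrightarrow>
     \<pi> \<noteq> [] \<and> last \<pi> = 1 \<and>
     (\<forall>i < length \<pi>. mc_step V P (set (take i \<pi>)) (\<pi> ! i))"

definition mc_degree :: "('v, 'k::field) mpoly list \<Rightarrow> nat" where
  "mc_degree \<pi> = Max (total_degree ` set \<pi>)"

definition mc_size :: "('v, 'k::field) mpoly list \<Rightarrow> nat" where
  "mc_size \<pi> = (\<Sum>p \<leftarrow> \<pi>. num_monomials p)"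

subsection \<open>Pebbling formulas\<close>

definition peb_axiom :: "'a pair_pre_digraph \<Rightarrow> 'a \<Rightarrow> ('a, 'k::field) mpoly" where
  "peb_axiom G v = (\<Prod>u \<in> preds G v. mvar u) * (1 - mvar v)"

definition Peb :: "'a pair_pre_digraph \<Rightarrow> 'a \<Rightarrow> ('a, 'k::field) mpoly set" where
  "Peb G z = insert (mvar z) (peb_axiom G ` pverts G)"

end

theory Submission
  imports Defs
begin

text \<open>Identify a monomial with its set of variables, so that multiplying an axiom of a vertex
  \<open>v\<close> by a monomial yields a difference of two sets that are one placement and one removal of
  \<open>v\<close> apart. Let \<open>R\<close> be the collection of sets reachable from \<open>{}\<close> by pebbling moves through sets
  that occur in the refutation. If no member of \<open>R\<close> contained the sink, then summing the
  coefficients of the monomials in \<open>R\<close> would give a linear functional that vanishes on every line: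
  on multiples of axioms because the two terms are both in \<open>R\<close> or both outside, and under
  multiplication of a monomial because pebbles can always be removed. But it is 1 on the line 1.
  So some simple path of moves leads to a set with the sink, and its length is at most the number
  of monomials in the refutation; it remains to remove the at most \<open>s\<close> pebbles left.\<close>

section \<open>A linear functional on polynomials\<close>

definition coeff_sum :: "'v set set \<Rightarrow> ('v, 'k::field) mpoly \<Rightarrow> 'k" where
  "coeff_sum R p =
     (\<Sum>m \<in> Poly_Mapping.keys p. if Poly_Mapping.keys m \<in> R then Poly_Mapping.lookup p m else 0)"

definition supports :: "('v, 'k::field) mpoly set \<Rightarrow> 'v set set" where
  "supports ps = (\<Union>p \<in> ps. Poly_Mapping.keys ` Poly_Mapping.keys p)"

lemma supportsI:
  "p \<in> ps \<Longrightarrow> m \<in> Poly_Mapping.keys p \<Longrightarrow> Poly_Mapping.keys m \<in> supports ps"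
  by (auto simp: supports_def)

text \<open>Exponents outside the keys have coefficient zero. A common index set is needed because
  keys can cancel in a sum.\<close>

lemma coeff_sum_superset:
  assumes "finite A" "Poly_Mapping.keys p \<subseteq> A"
  shows "coeff_sum R p = (\<Sum>m \<in> A. if Poly_Mapping.keys m \<in> R then Poly_Mapping.lookup p m else 0)"
  unfolding coeff_sum_def
  by (rule sum.mono_neutral_left) (use assms in \<open>auto simp: in_keys_iff\<close>)

lemma coeff_sum_add: "coeff_sum R (p + q) = coeff_sum R p + coeff_sum R q"
proof -
  let ?A = "Poly_Mapping.keys p \<union> Poly_Mapping.keys q"
  have sub: "finite ?A" "Poly_Mapping.keys (p + q) \<subseteq> ?A"
    "Poly_Mapping.keys p \<subseteq> ?A" "Poly_Mapping.keys q \<subseteq> ?A"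
    using Poly_Mapping.keys_add[of p q] by auto
  show ?thesis
    unfolding coeff_sum_superset[OF sub(1,2)] coeff_sum_superset[OF sub(1,3)]
      coeff_sum_superset[OF sub(1,4)] sum.distrib[symmetric]
    by (rule sum.cong) (auto simp: lookup_add)
qed

lemma coeff_sum_single:
  "coeff_sum R (Poly_Mapping.single m c) = (if Poly_Mapping.keys m \<in> R then c else 0)"
  by (auto simp: coeff_sum_def)

lemma lookup_mconst_mult:
  "Poly_Mapping.lookup (mconst a * p) m = a * Poly_Mapping.lookup p m"
proof -
  have "mconst a * p = Poly_Mapping.map ((*) a) p"
    unfolding mconst_def by (rule mult_map_scale_conv_mult[symmetric])
  then show ?thesis
    by (simp add: Poly_Mapping.map.rep_eq when_def)
qed

lemma coeff_sum_mconst_mult: "coeff_sum R (mconst a * p) = a * coeff_sum R p"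
proof -
  have "Poly_Mapping.keys (mconst a * p) \<subseteq> Poly_Mapping.keys p"
    by (auto simp: in_keys_iff lookup_mconst_mult)
  then show ?thesis
    by (subst coeff_sum_superset[of "Poly_Mapping.keys p"])
      (auto simp: coeff_sum_def lookup_mconst_mult sum_distrib_left intro!: sum.cong)
qed

lemma coeff_sum_single_diff:
  "coeff_sum R (Poly_Mapping.single m c - Poly_Mapping.single m' c) =
     (if Poly_Mapping.keys m \<in> R then c else 0) - (if Poly_Mapping.keys m' \<in> R then c else 0)"
proof -
  have "Poly_Mapping.single m c - Poly_Mapping.single m' c =
      Poly_Mapping.single m c + Poly_Mapping.single m' (- c)"
    by (simp add: single_uminus)
  then show ?thesis
    by (simp only: coeff_sum_add coeff_sum_single) auto
qed

section \<open>Supports of monomials\<close>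

lemma keys_single_diff:
  assumes "m \<noteq> m'" "c \<noteq> (0 :: 'k::field)"
  shows "Poly_Mapping.keys (Poly_Mapping.single m c - Poly_Mapping.single m' c) = {m, m'}"
  using assms by (auto simp: in_keys_iff lookup_minus lookup_single when_def split: if_splits)

text \<open>Natural exponents cannot cancel, so multiplying monomials unites their variable
  sets.\<close>

lemma keys_add_nat:
  fixes m m' :: "'v \<Rightarrow>\<^sub>0 nat"
  shows "Poly_Mapping.keys (m + m') = Poly_Mapping.keys m \<union> Poly_Mapping.keys m'"
  by (auto simp: in_keys_iff lookup_add)

lemma prod_mvar:
  "finite S \<Longrightarrow> (\<Prod>u \<in> S. mvar u) =
     (Poly_Mapping.single (\<Sum>u \<in> S. Poly_Mapping.single u 1) 1 :: ('v, 'k::field) mpoly)"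
  by (induction S rule: finite_induct) (simp_all add: mvar_def mult_single)

lemma keys_sum_single:
  "finite S \<Longrightarrow> Poly_Mapping.keys (\<Sum>u \<in> S. Poly_Mapping.single u (1::nat)) = S"
  by (induction S rule: finite_induct) (simp_all add: keys_add_nat)

lemma is_monomial_mvar_mult: "is_monomial m \<Longrightarrow> is_monomial (mvar v * m)"
  unfolding is_monomial_def mvar_def by (metis mult_single mult_1)

lemma is_monomial_one: "is_monomial 1"
  unfolding is_monomial_def by (metis single_one zero_neq_one)

section \<open>Vanishing of the functional on refutation lines\<close>

lemma pebbling_moves_insert:
  assumes "v \<in> pverts G" "preds G v \<subseteq> S" "v \<notin> S"
  shows "pebbling_move G S (insert v S)" "pebbling_move G (insert v S) S"
  using assms by (auto simp: pebbling_move_def)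

text \<open>The monomials of \<open>m * A\<close> must occur in the refutation for reachability to pass
  between them; as exponents are not reduced, they never cancel.\<close>
lemma coeff_sum_axiom_multiple:
  fixes m A :: "('a, 'k::field) mpoly"
  assumes fin: "\<And>v. v \<in> pverts G \<Longrightarrow> finite (preds G v)"
    and no_sink: "\<And>S. S \<in> R \<Longrightarrow> z \<notin> S"
    and closed: "\<And>S S'. S \<in> R \<Longrightarrow> S' \<in> M \<Longrightarrow> pebbling_move G S S' \<Longrightarrow> S' \<in> R"
    and m: "is_monomial m"
    and A: "A \<in> Peb G z \<union> boolean_axioms (pverts G)"
    and occ: "Poly_Mapping.keys ` Poly_Mapping.keys (m * A) \<subseteq> M"
  shows "coeff_sum R (m * A) = 0"
proof -
  obtain e c where m_eq: "m = Poly_Mapping.single e c" and c: "c \<noteq> 0"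
    using m by (auto simp: is_monomial_def)
  consider "A = mvar z" | v where "v \<in> pverts G" "A = peb_axiom G v"
    | v where "A = mvar v ^ 2 - mvar v"
    using A by (auto simp: Peb_def boolean_axioms_def)
  then show ?thesis
  proof cases
    \<comment> \<open>Every multiple of the sink axiom has \<open>z\<close> in its support, which
      puts it outside \<open>R\<close>.\<close>
    case 1
    then have "m * A = Poly_Mapping.single (e + Poly_Mapping.single z 1) c"
      by (simp add: m_eq mvar_def mult_single)
    then show ?thesis
      using no_sink by (auto simp: coeff_sum_single keys_add_nat)
  next
    case 2
    define d where "d = e + (\<Sum>u \<in> preds G v. Poly_Mapping.single u (1::nat))"
    define d' where "d' = d + Poly_Mapping.single v (1::nat)"
    have mA: "m * A = Poly_Mapping.single d c - Poly_Mapping.single d' c"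
      unfolding m_eq 2(2) peb_axiom_def prod_mvar[OF fin[OF 2(1)]]
      by (simp only: mvar_def right_diff_distrib mult_single mult_1_right add.assoc d_def d'_def)
    \<comment> \<open>The exponents differ at \<open>v\<close> even if \<open>v\<close> already
      divides the monomial, so both terms survive in \<open>m * A\<close>.\<close>
    have "Poly_Mapping.lookup d v \<noteq> Poly_Mapping.lookup d' v"
      by (simp add: d'_def lookup_add)
    then have "d \<noteq> d'"
      by auto
    then have "Poly_Mapping.keys (m * A) = {d, d'}"
      using c by (simp add: mA keys_single_diff)
    then have occ': "Poly_Mapping.keys d \<in> M" "Poly_Mapping.keys d' \<in> M"
      using occ by auto
    have d: "preds G v \<subseteq> Poly_Mapping.keys d"
      unfolding d_def keys_add_nat keys_sum_single[OF fin[OF 2(1)]] by simp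
    have d': "Poly_Mapping.keys d' = insert v (Poly_Mapping.keys d)"
      by (simp add: d'_def keys_add_nat)
    have "Poly_Mapping.keys d \<in> R \<longleftrightarrow> Poly_Mapping.keys d' \<in> R"
    proof (cases "v \<in> Poly_Mapping.keys d")
      case True
      then show ?thesis by (simp add: d' insert_absorb)
    next
      case False
      then show ?thesis
        using pebbling_moves_insert[OF 2(1) d False] closed occ' d' by metis
    qed
    then show ?thesis
      by (simp add: mA coeff_sum_single_diff)
  next
    case 3
    let ?d = "e + Poly_Mapping.single v (1::nat)"
    \<comment> \<open>The two terms have the same support and opposite coefficients, so their
      contributions cancel for any \<open>R\<close>.\<close>
    have "m * A = Poly_Mapping.single (?d + Poly_Mapping.single v 1) c - Poly_Mapping.single ?d c"
      unfolding m_eq 3 mvar_def power2_eq_square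
      by (simp only: right_diff_distrib mult_single mult_1_right add.assoc)
    then show ?thesis
      by (simp add: coeff_sum_single_diff keys_add_nat)
  qed
qed

lemma coeff_sum_refutation_line:
  fixes \<pi> :: "('a, 'k::field) mpoly list"
  assumes fin: "\<And>v. v \<in> pverts G \<Longrightarrow> finite (preds G v)"
    and no_sink: "\<And>S. S \<in> R \<Longrightarrow> z \<notin> S"
    and closed: "\<And>S S'. S \<in> R \<Longrightarrow> S' \<in> supports (set \<pi>) \<Longrightarrow> pebbling_move G S S' \<Longrightarrow> S' \<in> R"
    and ref: "mc_refutation (pverts G) (Peb G z) \<pi>"
    and "i < length \<pi>"
  shows "coeff_sum R (\<pi> ! i) = 0"
  using \<open>i < length \<pi>\<close>
proof (induction i rule: less_induct)
  case (less i)
  let ?q = "\<pi> ! i" and ?ps = "set (take i \<pi>)"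
  have IH: "coeff_sum R p = 0" if "p \<in> ?ps" for p
    using that less by (auto simp: in_set_conv_nth)
  have earlier: "p \<in> set \<pi>" if "p \<in> ?ps" for p
    using that by (rule in_set_takeD)
  have occ: "Poly_Mapping.keys ` Poly_Mapping.keys ?q \<subseteq> supports (set \<pi>)"
    using less.prems by (auto intro!: supportsI)
  have ax: "coeff_sum R ?q = 0"
    if "is_monomial m" "A \<in> Peb G z \<union> boolean_axioms (pverts G)" "?q = m * A" for m A
    unfolding that(3)
    by (rule coeff_sum_axiom_multiple[OF fin no_sink closed that(1,2) occ[unfolded that(3)]])
  have "mc_step (pverts G) (Peb G z) ?ps ?q"
    using ref less.prems by (simp add: mc_refutation_def)
  then consider "?q \<in> Peb G z \<union> boolean_axioms (pverts G)"
    | a b p p' where "p \<in> ?ps" "p' \<in> ?ps" "?q = mconst a * p + mconst b * p'"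
    | v p where "p \<in> ?ps" "?q = mvar v * p" "is_monomial p"
    | v m A where "A \<in> Peb G z \<union> boolean_axioms (pverts G)" "is_monomial m"
        "?q = mvar v * (m * A)"
    unfolding mc_step_def by blast
  then show ?case
  proof cases
    case 1
    then show ?thesis using ax[OF is_monomial_one] by simp
  next
    case 2
    then show ?thesis by (simp add: coeff_sum_add coeff_sum_mconst_mult IH)
  next
    case 3
    then obtain e c where p: "p = Poly_Mapping.single e c" and c: "c \<noteq> 0"
      by (auto simp: is_monomial_def)
    \<comment> \<open>On a single term the functional is \<open>c\<close> or 0; as it vanishes and
      \<open>c\<close> is nonzero, the support lies outside \<open>R\<close>.\<close>
    have notin: "Poly_Mapping.keys e \<notin> R"
      using IH[OF 3(1)] c by (simp add: p coeff_sum_single split: if_splits)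
    have occ_e: "Poly_Mapping.keys e \<in> supports (set \<pi>)"
      using earlier[OF 3(1)] c by (rule_tac supportsI) (auto simp: p)
    have "insert v (Poly_Mapping.keys e) \<notin> R"
    proof (cases "v \<in> Poly_Mapping.keys e")
      case True
      then show ?thesis using notin by (simp add: insert_absorb)
    next
      case False
      \<comment> \<open>Were the larger set in \<open>R\<close>, removing \<open>v\<close> would
        bring \<open>Poly_Mapping.keys e\<close> into \<open>R\<close> too.\<close>
      then have "pebbling_move G (insert v (Poly_Mapping.keys e)) (Poly_Mapping.keys e)"
        by (auto simp: pebbling_move_def)
      then show ?thesis using notin occ_e closed by blast
    qed
    moreover have "?q = Poly_Mapping.single (Poly_Mapping.single v 1 + e) c"
      by (simp add: 3 p mvar_def mult_single)
    ultimately show ?thesis by (simp add: coeff_sum_single keys_add_nat)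
  next
    case 4
    then show ?thesis
      using ax[OF is_monomial_mvar_mult[OF 4(2)] 4(1)] by (simp add: mult.assoc)
  qed
qed

section \<open>Reachability of the sink\<close>

lemma sink_reachable:
  fixes G :: "'a pair_pre_digraph" and \<pi> :: "('a, 'k::field) mpoly list"
  defines "r \<equiv> {(S, S'). S' \<in> supports (set \<pi>) \<and> pebbling_move G S S'}"
  assumes "single_sink_dag G z"
    and ref: "mc_refutation (pverts G) (Peb G z) \<pi>"
  shows "\<exists>B. ({}, B) \<in> r\<^sup>* \<and> z \<in> B"
proof (rule ccontr)
  assume none: "\<not> ?thesis"
  interpret pair_fin_digraph G
    using assms(2) by (simp add: single_sink_dag_def)
  have fin: "finite (preds G v)" for v
  proof (rule finite_subset)
    show "preds G v \<subseteq> pverts G"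
      by (auto simp: preds_def dest: in_arcsD1)
  qed simp
  let ?R = "{S. ({}, S) \<in> r\<^sup>*}"
  have \<pi>: "\<pi> \<noteq> []" "last \<pi> = 1"
    using ref by (auto simp: mc_refutation_def)
  have "coeff_sum ?R (\<pi> ! (length \<pi> - 1)) = 0"
  proof (rule coeff_sum_refutation_line[OF _ _ _ ref])
    fix S S' assume "S \<in> ?R" "S' \<in> supports (set \<pi>)" "pebbling_move G S S'"
    then show "S' \<in> ?R"
      by (auto simp: r_def intro: rtrancl_into_rtrancl)
  qed (use fin none \<pi> in auto)
  then have "coeff_sum ?R (1 :: ('a, 'k) mpoly) = 0"
    using \<pi> by (simp add: last_conv_nth)
  \<comment> \<open>The only monomial of 1 has support \<open>{}\<close>, which is reachable by
    reflexivity, so the functional is 1 there.\<close>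
  then show False
    by (simp add: coeff_sum_single flip: single_one)
qed

section \<open>Simple paths and removal of pebbles\<close>

text \<open>Loop erasure: if the next point is already on the path, the path is cut off right after
  that point. Distinctness will bound the length by the number of available sets.\<close>

lemma rtrancl_distinct_path:
  assumes "(x, y) \<in> r\<^sup>*"
  shows "\<exists>xs. xs \<noteq> [] \<and> hd xs = x \<and> last xs = y \<and> distinct xs
    \<and> successively (\<lambda>a b. (a, b) \<in> r) xs \<and> set xs \<subseteq> insert x (Range r)"
  using assms
proof (induction rule: rtrancl_induct)
  case base
  show ?case by (intro exI[of _ "[x]"]) simp
next
  case (step y z)
  then obtain xs where xs: "xs \<noteq> []" "hd xs = x" "last xs = y" "distinct xs"
    "successively (\<lambda>a b. (a, b) \<in> r) xs" "set xs \<subseteq> insert x (Range r)"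
    by blast
  show ?case
  proof (cases "z \<in> set xs")
    case True
    then obtain ys zs where "xs = (ys @ [z]) @ zs"
      by (auto simp: in_set_conv_decomp)
    then show ?thesis
      using xs by (intro exI[of _ "ys @ [z]"]) (auto simp: successively_append_iff hd_append split: if_splits)
  next
    case False
    then show ?thesis
      using xs step.hyps by (intro exI[of _ "xs @ [z]"]) (auto simp: successively_append_iff)
  qed
qed

lemma successively_nth_Suc:
  "successively P xs \<Longrightarrow> Suc i < length xs \<Longrightarrow> P (xs ! i) (xs ! Suc i)"
proof (induction xs arbitrary: i)
  case (Cons x xs)
  then show ?case
    by (cases i) (auto simp: successively_Cons hd_conv_nth)
qed simp

text \<open>Removals are always legal, so the pebbles can go one by one in any order, without
  leaving the subsets of \<open>B\<close>.\<close>

lemma unpebble: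
  assumes "finite B"
  shows "\<exists>Bs. Bs \<noteq> [] \<and> hd Bs = B \<and> last Bs = {} \<and> length Bs = Suc (card B)
    \<and> successively (pebbling_move G) Bs \<and> (\<forall>B' \<in> set Bs. B' \<subseteq> B)"
  using assms
proof (induction rule: finite_induct)
  case empty
  show ?case by (intro exI[of _ "[{}]"]) simp
next
  case (insert v B)
  then obtain Bs where Bs: "Bs \<noteq> []" "hd Bs = B" "last Bs = {}" "length Bs = Suc (card B)"
    "successively (pebbling_move G) Bs" "\<forall>B' \<in> set Bs. B' \<subseteq> B"
    by blast
  have "pebbling_move G (insert v B) B"
    using insert.hyps by (auto simp: pebbling_move_def)
  then show ?case
    using Bs insert.hyps
    by (intro exI[of _ "insert v B # Bs"]) (auto simp: successively_Cons)
qed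

lemma pebbling_move_subset:
  "pebbling_move G B B' \<Longrightarrow> B \<subseteq> pverts G \<Longrightarrow> B' \<subseteq> pverts G"
  by (auto simp: pebbling_move_def)

lemma successively_pebbling_move_subset:
  assumes "successively (pebbling_move G) Bs" "Bs \<noteq> []" "hd Bs \<subseteq> pverts G"
  shows "\<forall>B \<in> set Bs. B \<subseteq> pverts G"
  using assms
proof (induction Bs)
  case (Cons B Bs)
  then show ?case
    by (metis list.sel(1) set_ConsD successively_Cons pebbling_move_subset empty_iff list.set(1))
qed simp

section \<open>Size and degree as bounds on configurations\<close>

text \<open>Each support comes from a monomial counted in the size; monomials that share a support
  only make the count smaller.\<close>

lemma card_supports_le_mc_size:
  "finite (supports (set \<pi>)) \<and> card (supports (set \<pi>)) \<le> mc_size \<pi>"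
proof (induction \<pi>)
  case Nil
  show ?case by (simp add: supports_def)
next
  case (Cons p \<pi>)
  let ?K = "Poly_Mapping.keys ` Poly_Mapping.keys p"
  have eq: "supports (set (p # \<pi>)) = ?K \<union> supports (set \<pi>)"
    by (simp add: supports_def)
  have "card ?K \<le> num_monomials p"
    unfolding num_monomials_def by (rule card_image_le) simp
  then show ?case
    using Cons card_Un_le[of ?K "supports (set \<pi>)"] unfolding eq by (auto simp: mc_size_def)
qed

text \<open>Each variable that occurs has exponent at least 1.\<close>

lemma card_keys_le_monom_degree: "card (Poly_Mapping.keys m) \<le> monom_degree m"
proof -
  have "card (Poly_Mapping.keys m) = (\<Sum>v \<in> Poly_Mapping.keys m. 1)"
    by simp
  also have "\<dots> \<le> monom_degree m"
    unfolding monom_degree_def by (rule sum_mono) (simp add: in_keys_iff Suc_le_eq)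
  finally show ?thesis .
qed

lemma supports_bounded:
  assumes "S \<in> supports (set \<pi>)"
  shows "finite S" "card S \<le> mc_degree \<pi>"
proof -
  obtain p m where p: "p \<in> set \<pi>" and m: "m \<in> Poly_Mapping.keys p" and S: "S = Poly_Mapping.keys m"
    using assms by (auto simp: supports_def)
  show "finite S" by (simp add: S)
  have "card S \<le> monom_degree m"
    by (simp add: S card_keys_le_monom_degree)
  also have "\<dots> \<le> total_degree p"
    unfolding total_degree_def by (rule Max_ge) (use m in auto)
  also have "\<dots> \<le> mc_degree \<pi>"
    unfolding mc_degree_def by (rule Max_ge) (use p in auto)
  finally show "card S \<le> mc_degree \<pi>" .
qed

theorem theorem3p6:
  fixes G :: "'a pair_pre_digraph" and z :: 'a
    and \<pi> :: "('a, 'k::field) mpoly list" and s t :: nat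
  assumes "single_sink_dag G z"
    and "mc_refutation (pverts G) (Peb G z) \<pi>"
    and "mc_degree \<pi> = s"
    and "mc_size \<pi> = t"
  shows "\<exists>Bs. black_pebbling G z Bs \<and> pebbling_space Bs \<le> s \<and> pebbling_time Bs \<le> t + s"
proof -
  let ?M = "supports (set \<pi>)"
  let ?r = "{(S, S'). S' \<in> ?M \<and> pebbling_move G S S'}"
  obtain B where "({}, B) \<in> ?r\<^sup>*" and zB: "z \<in> B"
    using sink_reachable[OF assms(1,2)] by blast
  then obtain Bs where Bs: "Bs \<noteq> []" "hd Bs = {}" "last Bs = B" "distinct Bs"
    "successively (\<lambda>S S'. (S, S') \<in> ?r) Bs" "set Bs \<subseteq> insert {} (Range ?r)"
    using rtrancl_distinct_path[of "{}" B ?r] by blast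
  have "1 \<in> set \<pi>"
    using assms(2) by (metis last_in_set mc_refutation_def)
  then have "{} \<in> ?M"
    using supportsI[of 1 "set \<pi>" 0] by simp
  then have BsM: "set Bs \<subseteq> ?M"
    using Bs(6) by auto
  have len: "length Bs \<le> t"
    using card_mono[OF _ BsM] card_supports_le_mc_size[of \<pi>] distinct_card[OF Bs(4)] assms(4)
    by simp
  have BM: "B \<in> ?M"
    using BsM Bs(1,3) by (metis last_in_set subsetD)
  then have finB: "finite B" and cardB: "card B \<le> s"
    using supports_bounded assms(3) by auto
  obtain Cs where Cs: "Cs \<noteq> []" "hd Cs = B" "last Cs = {}" "length Cs = Suc (card B)"
    "successively (pebbling_move G) Cs" "\<forall>C \<in> set Cs. C \<subseteq> B"
    using unpebble[OF finB] by blast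
  \<comment> \<open>\<open>Bs\<close> ends in \<open>B\<close> and \<open>Cs\<close> starts with it;
    \<open>tl\<close> avoids a repeated configuration, which would not be a move.\<close>
  let ?Ds = "Bs @ tl Cs"
  have Cs_tl: "Cs = B # tl Cs"
    using Cs(1,2) by (metis list.collapse)
  have "successively (pebbling_move G) Bs"
    using Bs(5) by (rule successively_mono) auto
  then have moves: "successively (pebbling_move G) ?Ds"
    using Cs(5) Bs(1,3) by (subst (asm) Cs_tl) (auto simp: successively_append_iff successively_Cons)
  have hd: "hd ?Ds = {}" and ne: "?Ds \<noteq> []"
    using Bs by auto
  have last: "last ?Ds = {}"
    using Cs(3) Bs(3) by (subst (asm) Cs_tl) (auto split: if_splits)
  have zD: "\<exists>D \<in> set ?Ds. z \<in> D"
    using zB Bs(1,3) by (metis Un_iff last_in_set set_append)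
  have "\<forall>D \<in> set ?Ds. D \<subseteq> pverts G"
    by (rule successively_pebbling_move_subset[OF moves ne]) (simp add: hd)
  then have "black_pebbling G z ?Ds"
    unfolding black_pebbling_def using hd last ne zD moves
    by (auto simp: gr0_conv_Suc simp del: nth_append dest: successively_nth_Suc)
  moreover have "card D \<le> s" if "D \<in> set ?Ds" for D
  proof -
    consider "D \<in> set Bs" | "D \<in> set Cs"
      using \<open>D \<in> set ?Ds\<close> by (auto dest: list.set_sel(2)[OF Cs(1)])
    then show ?thesis
    proof cases
      case 1
      then show ?thesis using BsM supports_bounded(2) assms(3) by blast
    next
      case 2
      then show ?thesis using Cs(6) finB cardB by (meson card_mono order_trans)
    qed
  qed
  then have "pebbling_space ?Ds \<le> s"
    using ne unfolding pebbling_space_def by (subst Max_le_iff) auto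
  \<comment> \<open>\<open>?Ds\<close> has \<open>length Bs + card B\<close> entries, and its time
    is one less.\<close>
  moreover have "pebbling_time ?Ds \<le> t + s"
    using len cardB Cs(4) by (simp add: pebbling_time_def)
  ultimately show ?thesis by blast
qed

end
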